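(* Let $\alpha>0$, $n>0$, $\kappa>0$, $\theta_0\in\mathbb{R}$, $c_0=e^{\alpha\theta_0}$, and $\sigma_s(t)=\frac{1}{\alpha t+c_0}$. Consider the initial-boundary value problem on $0<x<1$, $t>0$, $$ \bar u_t=\sigma_s(t)\,\big(n\bar u_{xx}-\alpha\bar\theta_{xx}\big),\qquad \bar\theta_t-\kappa\bar\theta_{xx}=\sigma_s(t)\,\big((n+1)\bar u-\alpha\bar\theta\big), $$ $$ \bar u_x(0,t)=\bar u_x(1,t)=0,\qquad \bar\theta_x(0,t)=\bar\theta_x(1,t)=0, $$ with initial data $(\bar u,\bar\theta)(\cdot,0)=(\bar u_0,\bar\theta_0)$. If the initial perturbation $(\bar u_0,\bar\theta_0)$ satisfies $\int_0^1\bar u_0\,dx=0$, then the equilibrium $(0,0)$ is asymptotically stable in $L^2$.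
   Context: Subscripts $t$ and $x$ denote partial derivatives. Solutions are understood to be classical (sufficiently smooth on $[0,1]\times[0,\infty)$). "Asymptotically stable in $L^2$" (with respect to initial perturbations with $\int_0^1\bar u_0\,dx=0$) means: (a) for every $\varepsilon>0$ there is $\delta>0$ such that every solution with $\|\bar u_0\|_{L^2(0,1)}+\|\bar\theta_0\|_{L^2(0,1)}\le\delta$ satisfies $\|\bar u(\cdot,t)\|_{L^2(0,1)}+\|\bar\theta(\cdot,t)\|_{L^2(0,1)}\le\varepsilon$ for all $t\ge0$; and (b) $\|\bar u(\cdot,t)\|_{L^2(0,1)}+\|\bar\theta(\cdot,t)\|_{L^2(0,1)}\to0$ as $t\to\infty$. *)

theory Defs
  imports "HOL-Analysis.Analysis"
begin

definition sigma_s :: "real \<Rightarrow> real \<Rightarrow> real \<Rightarrow> real" where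
  "sigma_s \<alpha> \<theta>\<^sub>0 t = (let c\<^sub>0 = exp (\<alpha> * \<theta>\<^sub>0) in 1 / (\<alpha> * t + c\<^sub>0))"

definition L2_norm01 :: "(real \<Rightarrow> real) \<Rightarrow> real" where
  "L2_norm01 f = sqrt (integral {0..1} (\<lambda>x. (f x)\<^sup>2))"

text \<open>
  Regularity of classical solutions: \<open>f x t\<close> is continuously differentiable once in \<open>t\<close> and
  twice in \<open>x\<close> on the closed strip, with partial derivatives \<open>f_x\<close>, \<open>f_xx\<close>, \<open>f_t\<close> there. The
  derivatives are taken within the strip, hence are one-sided at \<open>x = 0\<close>, \<open>x = 1\<close> and \<open>t = 0\<close>;
  they are uniquely determined by \<open>f\<close> on the strip, and values of \<open>f\<close> elsewhere are irrelevant.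
\<close>

definition C21_strip ::
  "(real \<Rightarrow> real \<Rightarrow> real) \<Rightarrow> (real \<Rightarrow> real \<Rightarrow> real) \<Rightarrow> (real \<Rightarrow> real \<Rightarrow> real)
    \<Rightarrow> (real \<Rightarrow> real \<Rightarrow> real) \<Rightarrow> bool" where
  "C21_strip f f_x f_xx f_t \<longleftrightarrow>
    (\<forall>x\<in>{0..1}. \<forall>t\<in>{0..}.
      ((\<lambda>y. f y t) has_real_derivative f_x x t) (at x within {0..1}) \<and>
      ((\<lambda>y. f_x y t) has_real_derivative f_xx x t) (at x within {0..1}) \<and>
      ((\<lambda>s. f x s) has_real_derivative f_t x t) (at t within {0..})) \<and>
    (\<forall>g\<in>{f, f_x, f_xx, f_t}. continuous_on ({0..1} \<times> {0..}) (\<lambda>(x, t). g x t))"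

definition classical_solution ::
  "real \<Rightarrow> real \<Rightarrow> real \<Rightarrow> real \<Rightarrow> (real \<Rightarrow> real) \<Rightarrow> (real \<Rightarrow> real)
    \<Rightarrow> (real \<Rightarrow> real \<Rightarrow> real) \<Rightarrow> (real \<Rightarrow> real \<Rightarrow> real) \<Rightarrow> bool" where
  "classical_solution \<alpha> n \<kappa> \<theta>\<^sub>0 u_init \<theta>_init u \<theta> \<longleftrightarrow>
    (\<exists>u_x u_xx u_t \<theta>_x \<theta>_xx \<theta>_t.
      C21_strip u u_x u_xx u_t \<and> C21_strip \<theta> \<theta>_x \<theta>_xx \<theta>_t \<and>
      (\<forall>x t. 0 < x \<and> x < 1 \<and> 0 < t \<longrightarrow>
        u_t x t = sigma_s \<alpha> \<theta>\<^sub>0 t * (n * u_xx x t - \<alpha> * \<theta>_xx x t) \<and>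
        \<theta>_t x t - \<kappa> * \<theta>_xx x t = sigma_s \<alpha> \<theta>\<^sub>0 t * ((n + 1) * u x t - \<alpha> * \<theta> x t)) \<and>
      (\<forall>t>0. u_x 0 t = 0 \<and> u_x 1 t = 0 \<and> \<theta>_x 0 t = 0 \<and> \<theta>_x 1 t = 0) \<and>
      (\<forall>x\<in>{0..1}. u x 0 = u_init x \<and> \<theta> x 0 = \<theta>_init x))"

text \<open>
  Stability of \<open>(0, 0)\<close> with respect to initial data satisfying \<open>adm\<close>; here \<open>sol u\<^sub>0 \<theta>\<^sub>0 u \<theta>\<close> says
  that \<open>(u, \<theta>)\<close> is a solution with initial data \<open>(u\<^sub>0, \<theta>\<^sub>0)\<close>. Attraction is required of every
  solution with admissible data, not only of those starting near the equilibrium.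
\<close>

definition asymptotically_stable_L2 ::
  "((real \<Rightarrow> real) \<Rightarrow> (real \<Rightarrow> real) \<Rightarrow> bool)
    \<Rightarrow> ((real \<Rightarrow> real) \<Rightarrow> (real \<Rightarrow> real) \<Rightarrow> (real \<Rightarrow> real \<Rightarrow> real) \<Rightarrow> (real \<Rightarrow> real \<Rightarrow> real) \<Rightarrow> bool)
    \<Rightarrow> bool" where
  "asymptotically_stable_L2 adm sol \<longleftrightarrow>
    (\<forall>\<epsilon>>0. \<exists>\<delta>>0. \<forall>u\<^sub>0 \<theta>\<^sub>0 u \<theta>.
       adm u\<^sub>0 \<theta>\<^sub>0 \<and> sol u\<^sub>0 \<theta>\<^sub>0 u \<theta> \<and> L2_norm01 u\<^sub>0 + L2_norm01 \<theta>\<^sub>0 \<le> \<delta> \<longrightarrow>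
       (\<forall>t\<ge>0. L2_norm01 (\<lambda>x. u x t) + L2_norm01 (\<lambda>x. \<theta> x t) \<le> \<epsilon>)) \<and>
    (\<forall>u\<^sub>0 \<theta>\<^sub>0 u \<theta>.
       adm u\<^sub>0 \<theta>\<^sub>0 \<and> sol u\<^sub>0 \<theta>\<^sub>0 u \<theta> \<longrightarrow>
       ((\<lambda>t. L2_norm01 (\<lambda>x. u x t) + L2_norm01 (\<lambda>x. \<theta> x t)) \<longlongrightarrow> 0) at_top)"

end

theory Submission
  imports Defs
begin

text \<open>
  The weighted energy \<open>E = \<integral>u\<^sup>2 + A \<integral>\<theta>\<^sup>2\<close> with \<open>A = \<alpha>\<^sup>2 / (n c\<^sub>0 \<kappa>)\<close> is used. Half of the \<open>\<theta>\<close>-diffusion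
  absorbs the cross diffusion \<open>\<sigma> \<alpha> \<theta>\<^sub>x u\<^sub>x\<close>. As \<open>u\<close> keeps mean zero, \<open>\<theta>\<close> may be replaced by its
  mean-free part in \<open>\<integral>u \<theta>\<close>, so that by the Poincare inequality the other half absorbs the reaction
  term up to an error \<open>O(\<sigma>\<^sup>2) E\<close>. Hence \<open>E' \<le> (K \<sigma>\<^sup>2 - c \<sigma>) E\<close> with \<open>c > 0\<close>. Since \<open>\<sigma>\<^sup>2\<close> is integrable
  on the half line and \<open>\<sigma>\<close> is not, \<open>E\<close> is bounded by a multiple of its initial value and decays to
  zero, at an algebraic rate.
\<close>

section \<open>Poincare inequality for mean-free functions on the unit interval\<close>

text \<open>Cauchy-Schwarz in the guise of Young's inequality: integrate
  \<open>2 * v * f' y \<le> v\<^sup>2 + (f' y)\<^sup>2\<close> between \<open>z\<close> and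
  \<open>x\<close> with the constant \<open>v\<close> equal to \<open>f x\<close> up to sign. The
  left side becomes twice the square of \<open>f x\<close>, and one copy is absorbed because the
  interval has length at most 1.\<close>

lemma sq_le_integral_deriv_sq:
  fixes f f' :: "real \<Rightarrow> real"
  assumes deriv: "\<And>x. x \<in> {0..1} \<Longrightarrow> (f has_real_derivative f' x) (at x within {0..1})"
    and cont: "continuous_on {0..1} f'"
    and z: "z \<in> {0..1}" "f z = 0" and x: "x \<in> {0..1}"
  shows "(f x)\<^sup>2 \<le> integral {0..1} (\<lambda>y. (f' y)\<^sup>2)"
proof -
  define D where "D = integral {0..1} (\<lambda>y. (f' y)\<^sup>2)"
  have bound: "2 * v * (f b - f a) \<le> v\<^sup>2 + D" if ab: "0 \<le> a" "a \<le> b" "b \<le> 1" for a b v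
  proof -
    have sub: "{a..b} \<subseteq> {0..1}" using ab by auto
    have "(f' has_integral (f b - f a)) {a..b}"
      by (rule fundamental_theorem_of_calculus)
        (use ab in \<open>auto simp flip: has_real_derivative_iff_has_vector_derivative
          intro!: DERIV_subset[OF deriv sub]\<close>)
    then have "((\<lambda>y. 2 * v * f' y) has_integral 2 * v * (f b - f a)) {a..b}"
      by (rule has_integral_mult_right)
    moreover have int: "(\<lambda>y. v\<^sup>2 + (f' y)\<^sup>2) integrable_on {a..b}"
      by (intro integrable_continuous_real continuous_intros continuous_on_subset[OF cont] sub)
    moreover have "2 * v * f' y \<le> v\<^sup>2 + (f' y)\<^sup>2" for y
      using sum_squares_bound[of v "f' y"] by simp
    ultimately have "2 * v * (f b - f a) \<le> integral {a..b} (\<lambda>y. v\<^sup>2 + (f' y)\<^sup>2)"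
      by (meson has_integral_le integrable_integral)
    \<comment> \<open>The integrand is nonnegative, so the interval may be enlarged; over length 1
      the constant contributes exactly \<open>v\<^sup>2\<close>.\<close>
    also have "\<dots> \<le> integral {0..1} (\<lambda>y. v\<^sup>2 + (f' y)\<^sup>2)"
      by (intro integral_subset_le sub int integrable_continuous_real continuous_intros cont) auto
    also have "\<dots> = v\<^sup>2 + D"
      unfolding D_def
      by (subst integral_add)
        (auto intro!: integrable_continuous_real continuous_intros cont)
    finally show ?thesis .
  qed
  show ?thesis
  proof (cases "z \<le> x")
    case True
    then show ?thesis
      using bound[of z x "f x"] z x by (simp add: D_def power2_eq_square)
  next
    case False
    \<comment> \<open>Here \<open>z\<close> is the right endpoint and the increment is
      \<open>- f x\<close>; the sign of \<open>v\<close> is flipped to match.\<close>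
    then show ?thesis
      using bound[of x z "- f x"] z x by (simp add: D_def power2_eq_square)
  qed
qed

text \<open>The minimum is at most the mean and the maximum at least the mean, so the intermediate
  value property supplies a zero.\<close>

lemma zero_mean_has_zero:
  fixes f :: "real \<Rightarrow> real"
  assumes cont: "continuous_on {0..1} f" and mean: "integral {0..1} f = 0"
  obtains z where "z \<in> {0..1}" "f z = 0"
proof -
  have int: "f integrable_on {0..1}"
    using cont by (rule integrable_continuous_real)
  obtain p where p: "p \<in> {0..1}" "\<And>y. y \<in> {0..1} \<Longrightarrow> f p \<le> f y"
    using continuous_attains_inf[OF compact_Icc _ cont] by auto
  obtain q where q: "q \<in> {0..1}" "\<And>y. y \<in> {0..1} \<Longrightarrow> f y \<le> f q"
    using continuous_attains_sup[OF compact_Icc _ cont] by auto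
  have "f p \<le> 0"
    using integral_le[OF integrable_const_ivl[of "f p" 0 1] int] p(2) mean by auto
  moreover have "0 \<le> f q"
    using integral_le[OF int integrable_const_ivl[of "f q" 0 1]] q(2) mean by auto
  moreover have "connected (f ` {0..1})"
    using cont by (intro connected_continuous_image) auto
  ultimately have "0 \<in> f ` {0..1}"
    using p(1) q(1) by (meson connectedD_interval imageI)
  then show thesis using that by auto
qed

text \<open>The pointwise bound from a zero of \<open>f\<close> is integrated over an interval of
  length 1. The constant 1 is not sharp, but it suffices for the absorption arguments.\<close>

lemma poincare_zero_mean:
  fixes f f' :: "real \<Rightarrow> real"
  assumes deriv: "\<And>x. x \<in> {0..1} \<Longrightarrow> (f has_real_derivative f' x) (at x within {0..1})"
    and cont: "continuous_on {0..1} f'"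
    and mean: "integral {0..1} f = 0"
  shows "integral {0..1} (\<lambda>x. (f x)\<^sup>2) \<le> integral {0..1} (\<lambda>x. (f' x)\<^sup>2)"
proof -
  have cf: "continuous_on {0..1} f"
    using deriv by (rule DERIV_continuous_on)
  obtain z where "z \<in> {0..1}" "f z = 0"
    using zero_mean_has_zero[OF cf mean] .
  then have "(f x)\<^sup>2 \<le> integral {0..1} (\<lambda>y. (f' y)\<^sup>2)" if "x \<in> {0..1}" for x
    using sq_le_integral_deriv_sq[OF deriv cont] that by blast
  then have "integral {0..1} (\<lambda>x. (f x)\<^sup>2)
      \<le> integral {0..1} (\<lambda>x::real. integral {0..1} (\<lambda>y. (f' y)\<^sup>2))"
    by (intro integral_le integrable_continuous_real continuous_intros cf)
  then show ?thesis by simp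
qed

section \<open>Integration by parts and dissipation of the weighted energy\<close>

text \<open>In the applications \<open>g\<close> is a spatial derivative of a solution component, so
  its vanishing at both ends is the Neumann condition and removes the boundary term.\<close>

lemma integral_by_parts_neumann:
  fixes f f' g g' :: "real \<Rightarrow> real"
  assumes "\<And>x. x \<in> {0..1} \<Longrightarrow> (f has_real_derivative f' x) (at x within {0..1})"
    and "\<And>x. x \<in> {0..1} \<Longrightarrow> (g has_real_derivative g' x) (at x within {0..1})"
    and cont: "continuous_on {0..1} f'" "continuous_on {0..1} g'"
    and "g 0 = 0" "g 1 = 0"
  shows "integral {0..1} (\<lambda>x. f x * g' x) = - integral {0..1} (\<lambda>x. f' x * g x)"
proof -
  have cf: "continuous_on {0..1} f" "continuous_on {0..1} g"
    using DERIV_continuous_on assms(1,2) by blast+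
  have "((\<lambda>x. f x * g x) has_real_derivative f' x * g x + f x * g' x) (at x within {0..1})"
    if "x \<in> {0..1}" for x
    using assms(1,2)[OF that] by (auto intro!: derivative_eq_intros)
  then have "((\<lambda>x. f' x * g x + f x * g' x) has_integral (f 1 * g 1 - f 0 * g 0)) {0..1}"
    by (intro fundamental_theorem_of_calculus)
      (auto simp flip: has_real_derivative_iff_has_vector_derivative)
  then have "integral {0..1} (\<lambda>x. f' x * g x + f x * g' x) = 0"
    using assms(5,6) by (simp add: integral_unique)
  moreover have "integral {0..1} (\<lambda>x. f' x * g x + f x * g' x)
      = integral {0..1} (\<lambda>x. f' x * g x) + integral {0..1} (\<lambda>x. f x * g' x)"
    by (intro integral_add integrable_continuous_real continuous_intros cont cf)
  ultimately show ?thesis by simp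
qed

text \<open>This is the estimate at one fixed time, with \<open>s\<close> for the value of
  \<open>sigma_s\<close>: the left side is the time derivative of the energy after substitution of
  the equations. The rate \<open>min n (2 * \<alpha>)\<close> arises because \<open>u\<close> keeps
  damping \<open>n * s\<close> from half of its own diffusion, while \<open>\<theta>\<close> has
  damping \<open>2 * \<alpha> * s\<close> from the reaction term.\<close>

lemma energy_dissipation:
  fixes u u' u'' \<theta> \<theta>' \<theta>'' :: "real \<Rightarrow> real" and \<alpha> n \<kappa> s A :: real
  assumes u: "\<And>x. x \<in> {0..1} \<Longrightarrow> (u has_real_derivative u' x) (at x within {0..1})"
      "\<And>x. x \<in> {0..1} \<Longrightarrow> (u' has_real_derivative u'' x) (at x within {0..1})"
      "continuous_on {0..1} u''" "u' 0 = 0" "u' 1 = 0"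
    and \<theta>: "\<And>x. x \<in> {0..1} \<Longrightarrow> (\<theta> has_real_derivative \<theta>' x) (at x within {0..1})"
      "\<And>x. x \<in> {0..1} \<Longrightarrow> (\<theta>' has_real_derivative \<theta>'' x) (at x within {0..1})"
      "continuous_on {0..1} \<theta>''" "\<theta>' 0 = 0" "\<theta>' 1 = 0"
    and mean: "integral {0..1} u = 0"
    and pos: "\<alpha> > 0" "n > 0" "\<kappa> > 0" "s > 0" "A > 0"
    and weight: "s * \<alpha>\<^sup>2 \<le> A * \<kappa> * n"
  shows "integral {0..1} (\<lambda>x. 2 * u x * (s * (n * u'' x - \<alpha> * \<theta>'' x))
             + A * (2 * \<theta> x * (\<kappa> * \<theta>'' x + s * ((n + 1) * u x - \<alpha> * \<theta> x))))
         \<le> (A * (n + 1)\<^sup>2 / \<kappa> * s\<^sup>2 - min n (2 * \<alpha>) * s)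
             * (integral {0..1} (\<lambda>x. (u x)\<^sup>2) + A * integral {0..1} (\<lambda>x. (\<theta> x)\<^sup>2))"
    (is "?L \<le> (?K * s\<^sup>2 - ?c * s) * _")
proof -
  let ?I = "integral {0..1::real}"
  have c: "continuous_on {0..1} u" "continuous_on {0..1} u'"
    "continuous_on {0..1} \<theta>" "continuous_on {0..1} \<theta>'"
    using DERIV_continuous_on u(1,2) \<theta>(1,2) by blast+
  note cont = integrable_continuous_real continuous_intros c u(3) \<theta>(3)
  define m where "m = ?I \<theta>"
  define U where "U = ?I (\<lambda>x. (u x)\<^sup>2)"
  define T where "T = ?I (\<lambda>x. (\<theta> x)\<^sup>2)"
  define W where "W = ?I (\<lambda>x. (\<theta> x - m)\<^sup>2)"
  define P where "P = ?I (\<lambda>x. (u' x)\<^sup>2)"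
  define Q where "Q = ?I (\<lambda>x. (\<theta>' x)\<^sup>2)"
  define R where "R = ?I (\<lambda>x. u' x * \<theta>' x)"
  define X where "X = ?I (\<lambda>x. u x * \<theta> x)"
  have expand: "?L = 2 * s * n * ?I (\<lambda>x. u x * u'' x) - 2 * s * \<alpha> * ?I (\<lambda>x. u x * \<theta>'' x)
      + 2 * A * \<kappa> * ?I (\<lambda>x. \<theta> x * \<theta>'' x) + 2 * A * s * (n + 1) * X - 2 * A * s * \<alpha> * T"
  proof -
    have "?L = ?I (\<lambda>x. 2 * s * n * (u x * u'' x) - 2 * s * \<alpha> * (u x * \<theta>'' x)
      + 2 * A * \<kappa> * (\<theta> x * \<theta>'' x) + 2 * A * s * (n + 1) * (u x * \<theta> x) - 2 * A * s * \<alpha> * (\<theta> x)\<^sup>2)"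
      by (intro integral_cong) (simp add: algebra_simps power2_eq_square)
    also have "\<dots> = 2 * s * n * ?I (\<lambda>x. u x * u'' x) - 2 * s * \<alpha> * ?I (\<lambda>x. u x * \<theta>'' x)
      + 2 * A * \<kappa> * ?I (\<lambda>x. \<theta> x * \<theta>'' x) + 2 * A * s * (n + 1) * X - 2 * A * s * \<alpha> * T"
      unfolding X_def T_def
      by (rule integral_unique, intro has_integral_add has_integral_diff has_integral_mult_right
          integrable_integral cont)
    finally show ?thesis .
  qed
  have "?I (\<lambda>x. u x * u'' x) = - P"
    using integral_by_parts_neumann[OF u(1,2) c(2) u(3-5)]
    by (simp add: P_def power2_eq_square)
  moreover have "?I (\<lambda>x. u x * \<theta>'' x) = - R"
    using integral_by_parts_neumann[OF u(1) \<theta>(2) c(2) \<theta>(3-5)] by (simp add: R_def)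
  moreover have "?I (\<lambda>x. \<theta> x * \<theta>'' x) = - Q"
    using integral_by_parts_neumann[OF \<theta>(1,2) c(4) \<theta>(3-5)]
    by (simp add: Q_def power2_eq_square)
  ultimately have L: "?L = - 2 * s * n * P + 2 * s * \<alpha> * R - 2 * A * \<kappa> * Q
      + 2 * A * s * (n + 1) * X - 2 * A * s * \<alpha> * T"
    using expand by simp
  have UP: "U \<le> P"
    unfolding U_def P_def by (rule poincare_zero_mean[OF u(1) c(2) mean])
  have WQ: "W \<le> Q"
    unfolding W_def Q_def
  proof (rule poincare_zero_mean[OF _ c(4)])
    show "((\<lambda>x. \<theta> x - m) has_real_derivative \<theta>' x) (at x within {0..1})"
      if "x \<in> {0..1}" for x
      using \<theta>(1)[OF that] by (auto intro!: derivative_eq_intros)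
    show "?I (\<lambda>x. \<theta> x - m) = 0"
      by (subst integral_diff) (auto intro!: cont simp: m_def)
  qed
  \<comment> \<open>Young's inequality weighted so that, after multiplication by \<open>s\<close>,
    exactly half of the diffusion \<open>2 * s * n * P\<close> is spent.\<close>
  have cross_diffusion: "2 * \<alpha> * R \<le> n * P + \<alpha>\<^sup>2 / n * Q"
  proof -
    have "2 * \<alpha> * R = ?I (\<lambda>x. 2 * \<alpha> * (u' x * \<theta>' x))"
      by (simp add: R_def)
    also have "\<dots> \<le> ?I (\<lambda>x. n * (u' x)\<^sup>2 + \<alpha>\<^sup>2 / n * (\<theta>' x)\<^sup>2)"
    proof (intro integral_le cont)
      show "2 * \<alpha> * (u' x * \<theta>' x) \<le> n * (u' x)\<^sup>2 + \<alpha>\<^sup>2 / n * (\<theta>' x)\<^sup>2" for x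
      proof -
        have "0 \<le> (n * u' x - \<alpha> * \<theta>' x)\<^sup>2 / n" using pos by simp
        also have "\<dots> = n * (u' x)\<^sup>2 + \<alpha>\<^sup>2 / n * (\<theta>' x)\<^sup>2 - 2 * \<alpha> * (u' x * \<theta>' x)"
          using pos by (simp add: field_simps power2_eq_square)
        finally show ?thesis by simp
      qed
    qed
    also have "\<dots> = n * P + \<alpha>\<^sup>2 / n * Q"
      unfolding P_def Q_def
      by (rule integral_unique, intro has_integral_add has_integral_mult_right
          integrable_integral cont)
    finally show ?thesis .
  qed
  \<comment> \<open>Subtracting the mean \<open>m\<close> from \<open>\<theta>\<close> leaves
    \<open>X\<close> unchanged because \<open>u\<close> has mean zero. Weighting by
    \<open>\<kappa>\<close> puts the whole factor \<open>s\<close> on \<open>u\<close>, so the error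
    is quadratic in \<open>s\<close>.\<close>
  have reaction: "2 * s * (n + 1) * X \<le> \<kappa> * W + (n + 1)\<^sup>2 / \<kappa> * s\<^sup>2 * U"
  proof -
    have "?I (\<lambda>x. u x * (\<theta> x - m)) = ?I (\<lambda>x. u x * \<theta> x - m * u x)"
      by (simp add: algebra_simps)
    also have "\<dots> = X - m * ?I u"
      unfolding X_def by (subst integral_diff) (auto intro!: cont)
    finally have "2 * s * (n + 1) * X = ?I (\<lambda>x. 2 * s * (n + 1) * (u x * (\<theta> x - m)))"
      by (simp add: mean)
    also have "\<dots> \<le> ?I (\<lambda>x. \<kappa> * (\<theta> x - m)\<^sup>2 + (n + 1)\<^sup>2 / \<kappa> * s\<^sup>2 * (u x)\<^sup>2)"
    proof (intro integral_le cont)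
      show "2 * s * (n + 1) * (u x * (\<theta> x - m))
          \<le> \<kappa> * (\<theta> x - m)\<^sup>2 + (n + 1)\<^sup>2 / \<kappa> * s\<^sup>2 * (u x)\<^sup>2" for x
      proof -
        have "0 \<le> (\<kappa> * (\<theta> x - m) - s * (n + 1) * u x)\<^sup>2 / \<kappa>" using pos by simp
        also have "\<dots> = \<kappa> * (\<theta> x - m)\<^sup>2 + (n + 1)\<^sup>2 / \<kappa> * s\<^sup>2 * (u x)\<^sup>2
            - 2 * s * (n + 1) * (u x * (\<theta> x - m))"
          using pos by (simp add: power2_diff power_mult_distrib add_divide_distrib
              diff_divide_distrib) (simp add: power2_eq_square)
        finally show ?thesis by simp
      qed
    qed
    also have "\<dots> = \<kappa> * W + (n + 1)\<^sup>2 / \<kappa> * s\<^sup>2 * U"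
      unfolding U_def W_def
      by (rule integral_unique, intro has_integral_add has_integral_mult_right
          integrable_integral cont)
    finally show ?thesis .
  qed
  have nonneg: "0 \<le> U" "0 \<le> T" "0 \<le> Q"
    unfolding U_def T_def Q_def by (intro integral_nonneg cont; simp)+
  have 1: "s * (2 * \<alpha> * R) \<le> s * n * P + A * \<kappa> * Q"
  proof -
    have "s * (2 * \<alpha> * R) \<le> s * (n * P + \<alpha>\<^sup>2 / n * Q)"
      using cross_diffusion pos by (intro mult_left_mono) auto
    also have "\<dots> = s * n * P + (s * \<alpha>\<^sup>2 / n) * Q" by (simp add: algebra_simps)
    also have "\<dots> \<le> s * n * P + A * \<kappa> * Q"
      using weight pos nonneg(3) by (intro add_left_mono mult_right_mono) (auto simp: field_simps)
    finally show ?thesis .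
  qed
  have 2: "A * (2 * s * (n + 1) * X) \<le> A * (\<kappa> * Q + (n + 1)\<^sup>2 / \<kappa> * s\<^sup>2 * U)"
    using reaction WQ pos by (intro mult_left_mono) (auto intro: order_trans[OF reaction])
  have 3: "s * n * U \<le> s * n * P"
    using UP pos by simp
  \<comment> \<open>Facts 1 and 2 each use \<open>A * \<kappa> * Q\<close>, which together exhaust
    the \<open>\<theta>\<close>-diffusion; the remaining half of the \<open>u\<close>-diffusion is
    turned into damping of \<open>U\<close> by fact 3.\<close>
  have "?L \<le> - s * n * U + A * ((n + 1)\<^sup>2 / \<kappa> * s\<^sup>2 * U) - 2 * A * s * \<alpha> * T"
    unfolding L using 1 2 3 by (simp add: algebra_simps)
  also have "\<dots> = ?K * s\<^sup>2 * U - n * (s * U) - (2 * \<alpha>) * (s * A * T)"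
    by (simp add: algebra_simps)
  also have "\<dots> \<le> ?K * s\<^sup>2 * (U + A * T) - ?c * (s * U) - ?c * (s * A * T)"
    using pos nonneg by (intro diff_mono mult_mono mult_left_mono mult_right_mono) auto
  also have "\<dots> = (?K * s\<^sup>2 - ?c * s) * (U + A * T)"
    by (simp add: algebra_simps)
  finally show ?thesis by (simp add: U_def T_def)
qed

section \<open>Differentiation of spatial integrals in time\<close>

lemma strip_integral_has_derivative:
  fixes g g_t :: "real \<Rightarrow> real \<Rightarrow> real"
  assumes deriv: "\<And>x t. x \<in> {0..1} \<Longrightarrow> t \<in> {0..} \<Longrightarrow>
      ((\<lambda>s. g x s) has_real_derivative g_t x t) (at t within {0..})"
    and g: "continuous_on ({0..1} \<times> {0..}) (\<lambda>(x, t). g x t)"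
    and g_t: "continuous_on ({0..1} \<times> {0..}) (\<lambda>(x, t). g_t x t)"
    and t: "0 \<le> t"
  shows "((\<lambda>t. integral {0..1} (\<lambda>x. g x t)) has_real_derivative
      integral {0..1} (\<lambda>x. g_t x t)) (at t within {0..})"
proof -
  \<comment> \<open>The Leibniz rule expects the parameter as first argument, so the coordinates are
    swapped.\<close>
  have "continuous_on ({0..} \<times> {0..1}) ((\<lambda>(x, t). g_t x t) \<circ> prod.swap)"
    by (intro continuous_on_compose continuous_on_swap)
      (rule continuous_on_subset[OF g_t], auto)
  then have "continuous_on ({0..} \<times> cbox 0 1) (\<lambda>(t, x). g_t x t)"
    by (simp add: comp_def case_prod_unfold)
  moreover have "(\<lambda>x. g x t) integrable_on cbox 0 1" if "t \<in> {0..}" for t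
  proof -
    have "continuous_on {0..1} ((\<lambda>(x, t). g x t) \<circ> (\<lambda>x. (x, t)))"
      by (intro continuous_on_compose continuous_intros)
        (rule continuous_on_subset[OF g], use that in auto)
    then show ?thesis by (simp add: comp_def integrable_continuous_real)
  qed
  ultimately show ?thesis
    using leibniz_rule_field_derivative[of "{0..}" 0 1 "\<lambda>t x. g x t" "\<lambda>t x. g_t x t" t] deriv t
    by (simp add: convex_real_interval)
qed

lemma C21_stripD:
  assumes "C21_strip f f_x f_xx f_t"
  shows "\<And>x t. x \<in> {0..1} \<Longrightarrow> t \<in> {0..} \<Longrightarrow>
      ((\<lambda>y. f y t) has_real_derivative f_x x t) (at x within {0..1})"
    and "\<And>x t. x \<in> {0..1} \<Longrightarrow> t \<in> {0..} \<Longrightarrow>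
      ((\<lambda>y. f_x y t) has_real_derivative f_xx x t) (at x within {0..1})"
    and "\<And>x t. x \<in> {0..1} \<Longrightarrow> t \<in> {0..} \<Longrightarrow>
      ((\<lambda>s. f x s) has_real_derivative f_t x t) (at t within {0..})"
    and "continuous_on ({0..1} \<times> {0..}) (\<lambda>(x, t). f x t)"
    and "continuous_on ({0..1} \<times> {0..}) (\<lambda>(x, t). f_t x t)"
    and "\<And>t. t \<in> {0..} \<Longrightarrow> continuous_on {0..1} (\<lambda>x. f x t)"
    and "\<And>t. t \<in> {0..} \<Longrightarrow> continuous_on {0..1} (\<lambda>x. f_xx x t)"
    and "\<And>t. t \<in> {0..} \<Longrightarrow> continuous_on {0..1} (\<lambda>x. f_t x t)"
proof -
  have slice: "continuous_on {0..1} (\<lambda>x. g x t)"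
    if g: "continuous_on ({0..1} \<times> {0..}) (\<lambda>(x, t). g x t)" and "t \<in> {0..}"
    for g :: "real \<Rightarrow> real \<Rightarrow> real" and t
  proof -
    have "continuous_on {0..1} ((\<lambda>(x, t). g x t) \<circ> (\<lambda>x. (x, t)))"
      by (intro continuous_on_compose continuous_intros)
        (rule continuous_on_subset[OF g], use that in auto)
    then show ?thesis by (simp add: comp_def)
  qed
  show "\<And>x t. x \<in> {0..1} \<Longrightarrow> t \<in> {0..} \<Longrightarrow>
      ((\<lambda>y. f y t) has_real_derivative f_x x t) (at x within {0..1})"
    "\<And>x t. x \<in> {0..1} \<Longrightarrow> t \<in> {0..} \<Longrightarrow>
      ((\<lambda>y. f_x y t) has_real_derivative f_xx x t) (at x within {0..1})"
    "\<And>x t. x \<in> {0..1} \<Longrightarrow> t \<in> {0..} \<Longrightarrow>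
      ((\<lambda>s. f x s) has_real_derivative f_t x t) (at t within {0..})"
    "continuous_on ({0..1} \<times> {0..}) (\<lambda>(x, t). f x t)"
    "continuous_on ({0..1} \<times> {0..}) (\<lambda>(x, t). f_t x t)"
    using assms unfolding C21_strip_def by blast+
  show "\<And>t. t \<in> {0..} \<Longrightarrow> continuous_on {0..1} (\<lambda>x. f x t)"
    "\<And>t. t \<in> {0..} \<Longrightarrow> continuous_on {0..1} (\<lambda>x. f_xx x t)"
    "\<And>t. t \<in> {0..} \<Longrightarrow> continuous_on {0..1} (\<lambda>x. f_t x t)"
    using assms unfolding C21_strip_def by (blast intro: slice)+
qed

text \<open>The first derivative serves conservation of the mean, the second the energy.\<close>

lemma C21_strip_integral_derivs:
  assumes "C21_strip f f_x f_xx f_t" "0 \<le> t"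
  shows "((\<lambda>t. integral {0..1} (\<lambda>x. f x t)) has_real_derivative
      integral {0..1} (\<lambda>x. f_t x t)) (at t within {0..})"
    and "((\<lambda>t. integral {0..1} (\<lambda>x. (f x t)\<^sup>2)) has_real_derivative
      integral {0..1} (\<lambda>x. 2 * f x t * f_t x t)) (at t within {0..})"
proof -
  note f = C21_stripD[OF assms(1)]
  show "((\<lambda>t. integral {0..1} (\<lambda>x. f x t)) has_real_derivative
      integral {0..1} (\<lambda>x. f_t x t)) (at t within {0..})"
    using f(3-5) assms(2) by (rule strip_integral_has_derivative)
  show "((\<lambda>t. integral {0..1} (\<lambda>x. (f x t)\<^sup>2)) has_real_derivative
      integral {0..1} (\<lambda>x. 2 * f x t * f_t x t)) (at t within {0..})"
  proof (rule strip_integral_has_derivative[OF _ _ _ assms(2)])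
    show "((\<lambda>s. (f x s)\<^sup>2) has_real_derivative 2 * f x t * f_t x t) (at t within {0..})"
      if "x \<in> {0..1}" "t \<in> {0..}" for x t
      using f(3)[OF that] by (auto intro!: derivative_eq_intros)
    show "continuous_on ({0..1} \<times> {0..}) (\<lambda>(x, t). (f x t)\<^sup>2)"
      unfolding case_prod_unfold by (intro continuous_intros f(4)[unfolded case_prod_unfold])
    show "continuous_on ({0..1} \<times> {0..}) (\<lambda>(x, t). 2 * f x t * f_t x t)"
      unfolding case_prod_unfold by (intro continuous_intros f(4,5)[unfolded case_prod_unfold])
  qed
qed

section \<open>Comparison on the half line with the coefficient \<open>sigma_s\<close>\<close>

text \<open>The sign of \<open>F'\<close> is asked only for positive times because the equations and
  boundary conditions hold only there; continuity extends the conclusion to time 0.\<close>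

lemma nonincreasing_on_halfline:
  fixes F F' :: "real \<Rightarrow> real"
  assumes deriv: "\<And>t. 0 \<le> t \<Longrightarrow> (F has_real_derivative F' t) (at t within {0..})"
    and nonpos: "\<And>t. 0 < t \<Longrightarrow> F' t \<le> 0" and "0 \<le> t"
  shows "F t \<le> F 0"
proof (cases "t = 0")
  case False
  have "continuous_on {0..} F"
    using deriv by (auto intro: DERIV_continuous_on)
  then have "continuous_on {0..t} F"
    by (rule continuous_on_subset) auto
  moreover have "(F has_real_derivative F' s) (at s)" if "0 < s" for s
  proof -
    have "at s within {0..} = at s"
      using that by (intro at_within_interior) simp
    then show ?thesis
      using deriv[of s] that by simp
  qed
  ultimately show ?thesis
    using False \<open>0 \<le> t\<close> nonpos DERIV_nonpos_imp_decreasing_open[of 0 t F]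
    by (meson less_eq_real_def)
qed simp

lemma sigma_s_pos: "\<alpha> > 0 \<Longrightarrow> 0 \<le> t \<Longrightarrow> 0 < sigma_s \<alpha> \<theta>\<^sub>0 t"
  by (simp add: sigma_s_def add_nonneg_pos)

text \<open>This Riccati equation makes \<open>sigma_s\<close> and its logarithm, up to the factor
  \<open>- \<alpha>\<close>, antiderivatives of the square of \<open>sigma_s\<close> and of
  \<open>sigma_s\<close> itself.\<close>

lemma sigma_s_has_derivative:
  assumes "\<alpha> > 0" "0 \<le> t"
  shows "(sigma_s \<alpha> \<theta>\<^sub>0 has_real_derivative - \<alpha> * (sigma_s \<alpha> \<theta>\<^sub>0 t)\<^sup>2) (at t within S)"
proof -
  have "0 < \<alpha> * t + exp (\<alpha> * \<theta>\<^sub>0)"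
    using assms by (simp add: add_nonneg_pos)
  then show ?thesis
    unfolding sigma_s_def[abs_def] Let_def
    by (auto intro!: derivative_eq_intros simp: power2_eq_square field_simps)
qed

lemma sigma_s_antimono: "\<alpha> > 0 \<Longrightarrow> 0 \<le> t \<Longrightarrow> sigma_s \<alpha> \<theta>\<^sub>0 t \<le> sigma_s \<alpha> \<theta>\<^sub>0 0"
  by (simp add: sigma_s_def frac_le)

lemma sigma_s_tendsto_0:
  assumes "\<alpha> > 0"
  shows "(sigma_s \<alpha> \<theta>\<^sub>0 \<longlongrightarrow> 0) at_top"
proof -
  have "filterlim (\<lambda>t. exp (\<alpha> * \<theta>\<^sub>0) + \<alpha> * t) at_top at_top"
    by (intro filterlim_tendsto_add_at_top[OF tendsto_const]
        filterlim_tendsto_pos_mult_at_top[OF tendsto_const assms] filterlim_ident)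
  then have "((\<lambda>t. inverse (exp (\<alpha> * \<theta>\<^sub>0) + \<alpha> * t)) \<longlongrightarrow> 0) at_top"
    by (rule tendsto_inverse_0_at_top)
  then show ?thesis
    by (simp add: sigma_s_def[abs_def] inverse_eq_divide add.commute)
qed

text \<open>Gronwall's argument with an explicit integrating factor. The quadratic term contributes
  only a bounded factor, its integral being at most
  \<open>sigma_s \<alpha> \<theta>\<^sub>0 0 / \<alpha>\<close>, while the linear term integrates to
  a logarithm and thus yields a power of \<open>sigma_s\<close>.\<close>

lemma sigma_s_comparison:
  fixes E E' :: "real \<Rightarrow> real"
  assumes \<alpha>: "\<alpha> > 0" and K: "0 \<le> K"
    and deriv: "\<And>t. 0 \<le> t \<Longrightarrow> (E has_real_derivative E' t) (at t within {0..})"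
    and ineq: "\<And>t. 0 < t \<Longrightarrow> E' t \<le> (K * (sigma_s \<alpha> \<theta>\<^sub>0 t)\<^sup>2 - c * sigma_s \<alpha> \<theta>\<^sub>0 t) * E t"
    and E0: "0 \<le> E 0" and t: "0 \<le> t"
  shows "E t \<le> exp (K / \<alpha> * sigma_s \<alpha> \<theta>\<^sub>0 0)
      * (sigma_s \<alpha> \<theta>\<^sub>0 t / sigma_s \<alpha> \<theta>\<^sub>0 0) powr (c / \<alpha>) * E 0"
proof -
  define s where "s = sigma_s \<alpha> \<theta>\<^sub>0"
  \<comment> \<open>An antiderivative of \<open>c * s t - K * (s t)\<^sup>2\<close>, so that
    \<open>exp (G t) * E t\<close> is nonincreasing.\<close>
  define G where "G t = K / \<alpha> * s t - c / \<alpha> * ln (s t)" for t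
  have s: "0 < s t" "(s has_real_derivative - \<alpha> * (s t)\<^sup>2) (at t within {0..})" if "0 \<le> t" for t
    unfolding s_def using \<alpha> that by (rule sigma_s_pos sigma_s_has_derivative)+
  have G: "(G has_real_derivative c * s t - K * (s t)\<^sup>2) (at t within {0..})" if "0 \<le> t" for t
    unfolding G_def[abs_def] using s[OF that] \<alpha>
    by (auto intro!: derivative_eq_intros simp: field_simps power2_eq_square)
  have "exp (G t) * E t \<le> exp (G 0) * E 0"
  proof (rule nonincreasing_on_halfline[OF _ _ t])
    show "((\<lambda>t. exp (G t) * E t) has_real_derivative
        exp (G t) * ((c * s t - K * (s t)\<^sup>2) * E t + E' t)) (at t within {0..})" if "0 \<le> t" for t
      using G[OF that] deriv[OF that] by (auto intro!: derivative_eq_intros simp: algebra_simps)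
    show "exp (G t) * ((c * s t - K * (s t)\<^sup>2) * E t + E' t) \<le> 0" if "0 < t" for t
      using ineq[OF that] by (intro mult_nonneg_nonpos) (auto simp: s_def algebra_simps)
  qed
  then have "E t \<le> exp (G 0 - G t) * E 0"
    by (simp add: exp_diff field_simps)
  also have "\<dots> \<le> (exp (K / \<alpha> * s 0) * (s t / s 0) powr (c / \<alpha>)) * E 0"
  proof (rule mult_right_mono[OF _ E0])
    have "0 \<le> K / \<alpha> * s t" using K \<alpha> s(1)[OF t] by simp
    then have "G 0 - G t \<le> K / \<alpha> * s 0 + c / \<alpha> * ln (s t / s 0)"
      using s(1)[OF t] s(1)[of 0] by (simp add: G_def ln_div algebra_simps)
    then have "exp (G 0 - G t) \<le> exp (K / \<alpha> * s 0 + c / \<alpha> * ln (s t / s 0))"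
      by simp
    also have "\<dots> = exp (K / \<alpha> * s 0) * (s t / s 0) powr (c / \<alpha>)"
      using s(1)[OF t] s(1)[of 0] by (simp add: exp_add powr_def)
    finally show "exp (G 0 - G t) \<le> exp (K / \<alpha> * s 0) * (s t / s 0) powr (c / \<alpha>)" .
  qed
  finally show ?thesis by (simp add: s_def)
qed

section \<open>Energy decay along classical solutions\<close>

lemma classical_solution_energy_decay:
  fixes \<alpha> n \<kappa> \<theta>\<^sub>0 :: real
  assumes pos: "\<alpha> > 0" "n > 0" "\<kappa> > 0"
    and sol: "classical_solution \<alpha> n \<kappa> \<theta>\<^sub>0 u_init \<theta>_init u \<theta>"
    and mean: "integral {0..1} u_init = 0"
    and A: "A > 0" "sigma_s \<alpha> \<theta>\<^sub>0 0 * \<alpha>\<^sup>2 \<le> A * \<kappa> * n"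
    and t: "0 \<le> t"
  defines "E \<equiv> \<lambda>t. integral {0..1} (\<lambda>x. (u x t)\<^sup>2) + A * integral {0..1} (\<lambda>x. (\<theta> x t)\<^sup>2)"
  shows "E t \<le> exp (A * (n + 1)\<^sup>2 / \<kappa> / \<alpha> * sigma_s \<alpha> \<theta>\<^sub>0 0)
      * (sigma_s \<alpha> \<theta>\<^sub>0 t / sigma_s \<alpha> \<theta>\<^sub>0 0) powr (min n (2 * \<alpha>) / \<alpha>) * E 0"
proof -
  let ?I = "integral {0..1::real}" and ?s = "sigma_s \<alpha> \<theta>\<^sub>0"
  from sol obtain u_x u_xx u_t \<theta>_x \<theta>_xx \<theta>_t where
    C: "C21_strip u u_x u_xx u_t" "C21_strip \<theta> \<theta>_x \<theta>_xx \<theta>_t" and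
    pde: "\<And>x t. 0 < x \<Longrightarrow> x < 1 \<Longrightarrow> 0 < t \<Longrightarrow>
        u_t x t = ?s t * (n * u_xx x t - \<alpha> * \<theta>_xx x t)"
      "\<And>x t. 0 < x \<Longrightarrow> x < 1 \<Longrightarrow> 0 < t \<Longrightarrow>
        \<theta>_t x t - \<kappa> * \<theta>_xx x t = ?s t * ((n + 1) * u x t - \<alpha> * \<theta> x t)" and
    bc: "\<And>t. 0 < t \<Longrightarrow> u_x 0 t = 0 \<and> u_x 1 t = 0 \<and> \<theta>_x 0 t = 0 \<and> \<theta>_x 1 t = 0" and
    ic: "\<And>x. x \<in> {0..1} \<Longrightarrow> u x 0 = u_init x"
    unfolding classical_solution_def by blast
  note du = C21_stripD[OF C(1)] and d\<theta> = C21_stripD[OF C(2)]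
  \<comment> \<open>The equations hold only for \<open>0 < x < 1\<close>; substituting them under an
    integral over the closed interval leaves out these two points.\<close>
  have ends: "negligible {0, 1::real}" by simp
  \<comment> \<open>The right side of the \<open>u\<close>-equation is an exact
    \<open>x\<close>-derivative whose flux vanishes at both ends.\<close>
  have flux: "?I (\<lambda>x. u_t x t) = 0" if "0 < t" for t
  proof -
    have eq: "?I (\<lambda>x. u_t x t) = ?I (\<lambda>x. ?s t * (n * u_xx x t - \<alpha> * \<theta>_xx x t))"
      by (rule integral_spike[OF ends]) (use that pde in auto)
    have "((\<lambda>x. ?s t * (n * u_xx x t - \<alpha> * \<theta>_xx x t)) has_integral
        ?s t * (n * u_x 1 t - \<alpha> * \<theta>_x 1 t) - ?s t * (n * u_x 0 t - \<alpha> * \<theta>_x 0 t)) {0..1}"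
    proof (rule fundamental_theorem_of_calculus)
      show "((\<lambda>x. ?s t * (n * u_x x t - \<alpha> * \<theta>_x x t)) has_vector_derivative
          ?s t * (n * u_xx x t - \<alpha> * \<theta>_xx x t)) (at x within {0..1})" if "x \<in> {0..1}" for x
        unfolding has_real_derivative_iff_has_vector_derivative[symmetric]
        using du(2)[OF that, of t] d\<theta>(2)[OF that, of t] \<open>0 < t\<close>
        by (auto intro!: derivative_eq_intros)
    qed simp
    then have "?I (\<lambda>x. ?s t * (n * u_xx x t - \<alpha> * \<theta>_xx x t)) = 0"
      using bc[OF that] by (intro integral_unique) simp
    with eq show ?thesis by simp
  qed
  have mean_t: "?I (\<lambda>x. u x t) = 0" if "0 \<le> t" for t
  proof -
    have "?I (\<lambda>x. u x 0) = ?I u_init"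
      by (rule integral_cong[OF ic])
    with mean have m0: "?I (\<lambda>x. u x 0) = 0" by simp
    note D = C21_strip_integral_derivs(1)[OF C(1)]
    \<comment> \<open>Constancy of the mean comes from monotonicity applied to the mean and to its
      negative.\<close>
    have "?I (\<lambda>x. u x t) \<le> ?I (\<lambda>x. u x 0)"
      by (rule nonincreasing_on_halfline[OF D _ that]) (simp_all add: flux)
    moreover have "- ?I (\<lambda>x. u x t) \<le> - ?I (\<lambda>x. u x 0)"
      by (rule nonincreasing_on_halfline[OF DERIV_minus[OF D] _ that]) (simp_all add: flux)
    ultimately show ?thesis using m0 by simp
  qed
  define E' where "E' t = ?I (\<lambda>x. 2 * u x t * u_t x t) + A * ?I (\<lambda>x. 2 * \<theta> x t * \<theta>_t x t)" for t
  show ?thesis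
  proof (rule sigma_s_comparison[OF pos(1) _ _ _ _ t])
    show "0 \<le> A * (n + 1)\<^sup>2 / \<kappa>" using A pos by simp
    show "0 \<le> E 0"
      unfolding E_def using A du(6)[of 0] d\<theta>(6)[of 0]
      by (intro add_nonneg_nonneg mult_nonneg_nonneg integral_nonneg
          integrable_continuous_real continuous_intros) auto
    show "(E has_real_derivative E' t) (at t within {0..})" if "0 \<le> t" for t
      unfolding E_def E'_def
      by (intro DERIV_add DERIV_cmult C21_strip_integral_derivs(2)[OF C(1) that]
          C21_strip_integral_derivs(2)[OF C(2) that])
    show "E' t \<le> (A * (n + 1)\<^sup>2 / \<kappa> * (?s t)\<^sup>2 - min n (2 * \<alpha>) * ?s t) * E t" if "0 < t" for t
    proof -
      have t: "t \<in> {0..}" using that by simp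
      have "E' t = ?I (\<lambda>x. 2 * u x t * u_t x t + A * (2 * \<theta> x t * \<theta>_t x t))"
        unfolding E'_def
        by (subst integral_add)
          (auto intro!: integrable_continuous_real continuous_intros du(6,8)[OF t] d\<theta>(6,8)[OF t])
      also have "\<dots> = ?I (\<lambda>x. 2 * u x t * (?s t * (n * u_xx x t - \<alpha> * \<theta>_xx x t))
          + A * (2 * \<theta> x t * (\<kappa> * \<theta>_xx x t + ?s t * ((n + 1) * u x t - \<alpha> * \<theta> x t))))"
        by (rule integral_spike[OF ends]) (use that pde in \<open>auto simp flip: pde\<close>)
      also have "\<dots> \<le> (A * (n + 1)\<^sup>2 / \<kappa> * (?s t)\<^sup>2 - min n (2 * \<alpha>) * ?s t) * E t"
        unfolding E_def
      proof (rule energy_dissipation[OF du(1)[OF _ t] du(2)[OF _ t] du(7)[OF t] _ _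
            d\<theta>(1)[OF _ t] d\<theta>(2)[OF _ t] d\<theta>(7)[OF t]])
        \<comment> \<open>Since \<open>sigma_s\<close> decreases, the weight condition at time 0
          covers all later times.\<close>
        have "?s t * \<alpha>\<^sup>2 \<le> ?s 0 * \<alpha>\<^sup>2"
          using that pos by (intro mult_right_mono sigma_s_antimono) auto
        then show "?s t * \<alpha>\<^sup>2 \<le> A * \<kappa> * n" using A(2) by simp
      qed (use that pos A bc[OF that] mean_t in \<open>auto simp: sigma_s_pos\<close>)
      finally show ?thesis .
    qed
  qed
qed

section \<open>Norm equivalence and stability from a decaying linear bound\<close>

text \<open>Holds for arbitrary \<open>f\<close>, since the integral of a non-integrable function is
  0 by convention.\<close>

lemma L2_norm01_nonneg: "0 \<le> L2_norm01 f"
  unfolding L2_norm01_def by (cases "(\<lambda>x. (f x)\<^sup>2) integrable_on {0..1}")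
    (auto simp: integral_nonneg not_integrable_integral)

lemma L2_norm01_sq: "(L2_norm01 f)\<^sup>2 = integral {0..1} (\<lambda>x. (f x)\<^sup>2)"
  using L2_norm01_nonneg[of f] unfolding L2_norm01_def by simp

lemma L2_norm01_cong: "(\<And>x. x \<in> {0..1} \<Longrightarrow> f x = g x) \<Longrightarrow> L2_norm01 f = L2_norm01 g"
  unfolding L2_norm01_def by (intro arg_cong[where f = sqrt] integral_cong) simp

text \<open>Passes between the sum of norms in the definition of stability and the square root of
  the weighted energy, at the cost of constants depending only on \<open>A\<close>.\<close>

lemma add_le_sqrt_weighted:
  fixes a b A :: real
  assumes "A > 0" "0 \<le> a" "0 \<le> b"
  shows "a + b \<le> (1 + 1 / sqrt A) * sqrt (a\<^sup>2 + A * b\<^sup>2)"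
    and "sqrt (a\<^sup>2 + A * b\<^sup>2) \<le> (1 + sqrt A) * (a + b)"
proof -
  have "a \<le> sqrt (a\<^sup>2 + A * b\<^sup>2)"
    using assms by (intro real_le_rsqrt) simp
  moreover have "sqrt A * b \<le> sqrt (a\<^sup>2 + A * b\<^sup>2)"
    using assms by (intro real_le_rsqrt) (simp add: power_mult_distrib)
  then have "b \<le> 1 / sqrt A * sqrt (a\<^sup>2 + A * b\<^sup>2)"
    using assms by (simp add: field_simps)
  ultimately show "a + b \<le> (1 + 1 / sqrt A) * sqrt (a\<^sup>2 + A * b\<^sup>2)"
    by (simp add: algebra_simps)
  have "sqrt (a\<^sup>2 + A * b\<^sup>2) \<le> sqrt (a\<^sup>2) + sqrt (A * b\<^sup>2)"
    using assms by (intro sqrt_add_le_add_sqrt) auto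
  also have "\<dots> = a + sqrt A * b"
    using assms by (simp add: real_sqrt_mult)
  also have "\<dots> \<le> (1 + sqrt A) * (a + b)"
    using assms by (simp add: algebra_simps)
  finally show "sqrt (a\<^sup>2 + A * b\<^sup>2) \<le> (1 + sqrt A) * (a + b)" .
qed

text \<open>A bound linear in the initial norm gives both halves: \<open>\<rho> t \<le> 1\<close>
  allows the choice \<open>\<epsilon> / C\<close> for the radius, and the limit of
  \<open>\<rho>\<close> gives attraction for data of any size.\<close>

lemma asymptotically_stable_L2I:
  assumes bound: "\<And>u\<^sub>0 \<theta>\<^sub>0 u \<theta> t. adm u\<^sub>0 \<theta>\<^sub>0 \<Longrightarrow> sol u\<^sub>0 \<theta>\<^sub>0 u \<theta> \<Longrightarrow> 0 \<le> t \<Longrightarrow>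
      L2_norm01 (\<lambda>x. u x t) + L2_norm01 (\<lambda>x. \<theta> x t)
        \<le> C * \<rho> t * (L2_norm01 u\<^sub>0 + L2_norm01 \<theta>\<^sub>0)"
    and C: "0 < C" and \<rho>: "\<And>t. 0 \<le> t \<Longrightarrow> \<rho> t \<le> 1" and lim: "(\<rho> \<longlongrightarrow> 0) at_top"
  shows "asymptotically_stable_L2 adm sol"
  unfolding asymptotically_stable_L2_def
proof (intro conjI allI impI)
  fix \<epsilon> :: real assume \<epsilon>: "\<epsilon> > 0"
  have "L2_norm01 (\<lambda>x. u x t) + L2_norm01 (\<lambda>x. \<theta> x t) \<le> \<epsilon>"
    if *: "adm u\<^sub>0 \<theta>\<^sub>0" "sol u\<^sub>0 \<theta>\<^sub>0 u \<theta>" "L2_norm01 u\<^sub>0 + L2_norm01 \<theta>\<^sub>0 \<le> \<epsilon> / C" "0 \<le> t"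
    for u\<^sub>0 \<theta>\<^sub>0 u \<theta> t
  proof -
    have "C * \<rho> t * (L2_norm01 u\<^sub>0 + L2_norm01 \<theta>\<^sub>0) \<le> C * 1 * (L2_norm01 u\<^sub>0 + L2_norm01 \<theta>\<^sub>0)"
      using \<rho>[OF *(4)] C
      by (intro mult_right_mono mult_left_mono add_nonneg_nonneg L2_norm01_nonneg) auto
    then show ?thesis
      using bound[OF *(1,2,4)] *(3) C by (simp add: field_simps)
  qed
  then show "\<exists>\<delta>>0. \<forall>u\<^sub>0 \<theta>\<^sub>0 u \<theta>.
       adm u\<^sub>0 \<theta>\<^sub>0 \<and> sol u\<^sub>0 \<theta>\<^sub>0 u \<theta> \<and> L2_norm01 u\<^sub>0 + L2_norm01 \<theta>\<^sub>0 \<le> \<delta> \<longrightarrow>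
       (\<forall>t\<ge>0. L2_norm01 (\<lambda>x. u x t) + L2_norm01 (\<lambda>x. \<theta> x t) \<le> \<epsilon>)"
    using \<epsilon> C by (intro exI[of _ "\<epsilon> / C"]) auto
next
  fix u\<^sub>0 \<theta>\<^sub>0 u \<theta> assume *: "adm u\<^sub>0 \<theta>\<^sub>0 \<and> sol u\<^sub>0 \<theta>\<^sub>0 u \<theta>"
  have lim': "((\<lambda>t. C * \<rho> t * (L2_norm01 u\<^sub>0 + L2_norm01 \<theta>\<^sub>0)) \<longlongrightarrow> 0) at_top"
    using lim by (auto intro!: tendsto_eq_intros)
  have le: "\<forall>\<^sub>F t in at_top. L2_norm01 (\<lambda>x. u x t) + L2_norm01 (\<lambda>x. \<theta> x t)
      \<le> C * \<rho> t * (L2_norm01 u\<^sub>0 + L2_norm01 \<theta>\<^sub>0)"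
    using eventually_ge_at_top[of 0] by eventually_elim (use * bound in blast)
  show "((\<lambda>t. L2_norm01 (\<lambda>x. u x t) + L2_norm01 (\<lambda>x. \<theta> x t)) \<longlongrightarrow> 0) at_top"
    by (rule tendsto_sandwich[OF _ le tendsto_const lim']) (simp add: L2_norm01_nonneg)
qed

theorem proposition3p4:
  fixes \<alpha> n \<kappa> \<theta>\<^sub>0 :: real
  assumes "\<alpha> > 0" and "n > 0" and "\<kappa> > 0"
  shows "asymptotically_stable_L2
           (\<lambda>u_init \<theta>_init. integral {0..1} u_init = 0)
           (classical_solution \<alpha> n \<kappa> \<theta>\<^sub>0)"
proof -
  let ?s = "sigma_s \<alpha> \<theta>\<^sub>0"
  \<comment> \<open>Chosen so that the weight condition at time 0 holds with equality.\<close>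
  define A where "A = ?s 0 * \<alpha>\<^sup>2 / (\<kappa> * n)"
  define B where "B = exp (A * (n + 1)\<^sup>2 / \<kappa> / \<alpha> * ?s 0)"
  define r where "r = min n (2 * \<alpha>) / \<alpha>"
  \<comment> \<open>The energy is quadratic, so norms decay like the square root of its rate.
    Likewise \<open>C\<close> combines the square root of the factor \<open>B\<close> with the two
    norm equivalence constants.\<close>
  define \<rho> where "\<rho> t = sqrt ((?s t / ?s 0) powr r)" for t
  define C where "C = (1 + 1 / sqrt A) * sqrt B * (1 + sqrt A)"
  have s: "0 < ?s t" if "0 \<le> t" for t using assms(1) that by (rule sigma_s_pos)
  have A: "A > 0" "?s 0 * \<alpha>\<^sup>2 \<le> A * \<kappa> * n"
    using assms s[of 0] by (auto simp: A_def)
  have r: "r > 0" using assms by (simp add: r_def)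
  show ?thesis
  proof (rule asymptotically_stable_L2I)
    show "0 < C"
      using A by (simp add: C_def B_def add_pos_pos)
    show "\<rho> t \<le> 1" if "0 \<le> t" for t
    proof -
      have "(?s t / ?s 0) powr r \<le> 1 powr r"
        using s[OF that] s[of 0] r assms(1) that
        by (intro powr_mono2) (auto simp: sigma_s_antimono)
      then show ?thesis by (simp add: \<rho>_def)
    qed
    have "((\<lambda>t. ?s t / ?s 0) \<longlongrightarrow> 0) at_top"
      using sigma_s_tendsto_0[OF assms(1), of \<theta>\<^sub>0] s[of 0] by (auto intro!: tendsto_eq_intros)
    \<comment> \<open>The base of the power tends to 0, where \<open>powr\<close> is continuous only
      from the nonnegative side and for a positive exponent.\<close>
    moreover have "\<forall>\<^sub>F t in at_top. 0 \<le> ?s t / ?s 0"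
      using eventually_ge_at_top[of 0]
      by eventually_elim (use s in \<open>simp add: less_imp_le\<close>)
    ultimately have "((\<lambda>t. (?s t / ?s 0) powr r) \<longlongrightarrow> 0) at_top"
      using tendsto_powr'[OF _ tendsto_const, of _ 0 at_top r] r by simp
    then show "(\<rho> \<longlongrightarrow> 0) at_top"
      unfolding \<rho>_def[abs_def] using tendsto_real_sqrt by fastforce
  next
    fix u\<^sub>0 \<phi> u \<theta> and t :: real
    assume mean: "integral {0..1} u\<^sub>0 = 0" and t: "0 \<le> t"
      and sol: "classical_solution \<alpha> n \<kappa> \<theta>\<^sub>0 u\<^sub>0 \<phi> u \<theta>"
    define a where "a t = L2_norm01 (\<lambda>x. u x t)" for t
    define b where "b t = L2_norm01 (\<lambda>x. \<theta> x t)" for t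
    have nn: "0 \<le> a t" "0 \<le> b t" for t
      by (simp_all add: a_def b_def L2_norm01_nonneg)
    \<comment> \<open>The data agree with the solution at time 0 only on the unit interval, which is
      all that the norm sees.\<close>
    have init: "L2_norm01 u\<^sub>0 = a 0" "L2_norm01 \<phi> = b 0"
      using sol unfolding a_def b_def classical_solution_def
      by (auto intro!: L2_norm01_cong)
    have E: "(a t)\<^sup>2 + A * (b t)\<^sup>2 \<le> B * (?s t / ?s 0) powr r * ((a 0)\<^sup>2 + A * (b 0)\<^sup>2)"
      using classical_solution_energy_decay[OF assms sol mean A t]
      by (simp add: a_def b_def L2_norm01_sq B_def r_def)
    have "a t + b t \<le> (1 + 1 / sqrt A) * sqrt ((a t)\<^sup>2 + A * (b t)\<^sup>2)"
      by (rule add_le_sqrt_weighted(1)[OF A(1) nn])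
    also have "\<dots> \<le> (1 + 1 / sqrt A) * (sqrt B * \<rho> t * sqrt ((a 0)\<^sup>2 + A * (b 0)\<^sup>2))"
      using real_sqrt_le_mono[OF E] A(1)
      by (intro mult_left_mono) (auto simp: \<rho>_def real_sqrt_mult)
    also have "\<dots> \<le> (1 + 1 / sqrt A) * (sqrt B * \<rho> t * ((1 + sqrt A) * (a 0 + b 0)))"
      using add_le_sqrt_weighted(2)[OF A(1) nn] A(1)
      by (intro mult_left_mono) (auto simp: \<rho>_def B_def)
    also have "\<dots> = C * \<rho> t * (a 0 + b 0)"
      by (simp add: C_def)
    finally show "L2_norm01 (\<lambda>x. u x t) + L2_norm01 (\<lambda>x. \<theta> x t)
        \<le> C * \<rho> t * (L2_norm01 u\<^sub>0 + L2_norm01 \<phi>)"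
      by (simp add: init a_def b_def)
  qed
qed

end
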